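(* Let $K$ be a field of characteristic zero and $n\geq 2$. Then the set of elements $\partial_1,\ x_2^2\partial_1,\ x_3^2\partial_1,\ldots,x_n^2\partial_1,\ x_1^2\partial_2,\ x_1^2\partial_3,\ldots,x_1^2\partial_n$ is a minimal set of generators for the Lie algebra $\mathfrak{div}_n^0$.
   Context: $P_n=K[x_1,\ldots,x_n]$, $\partial_i=\partial/\partial x_i$, $D_n=\mathrm{Der}_K(P_n)=\bigoplus_{i=1}^n P_n\partial_i$ with bracket $[\partial,\delta]=\partial\delta-\delta\partial$. For $\partial=\sum_{i=1}^n a_i\partial_i\in D_n$, $\mathrm{div}(\partial)=\sum_{i=1}^n \partial a_i/\partial x_i$, and $\mathfrak{div}_n^0=\{\partial\in D_n : \mathrm{div}(\partial)=0\}$, a Lie subalgebra of $D_n$. A set of generators of a $K$-Lie algebra is minimal if no proper subset of it generates the Lie algebra. *)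

theory Defs
  imports "HOL-Library.Poly_Mapping" "HOL.Hull"
begin

text \<open>
  The polynomial ring \<open>P_n = K[x_1,\<dots>,x_n]\<close> is the monoid algebra over \<open>K = 'k\<close> of the monoid
  \<open>'n \<Rightarrow>\<^sub>0 nat\<close> of exponent vectors, where the finite type \<open>'n\<close> indexes the \<open>n = CARD('n)\<close> variables.
\<close>

type_synonym ('n, 'k) mpoly = "('n \<Rightarrow>\<^sub>0 nat) \<Rightarrow>\<^sub>0 'k"

type_synonym ('n, 'k) mpoly_op = "('n, 'k) mpoly \<Rightarrow> ('n, 'k) mpoly"

definition Const :: "'k \<Rightarrow> ('n, 'k::comm_ring_1) mpoly"
  where "Const c = Poly_Mapping.single 0 c"

definition X :: "'n \<Rightarrow> ('n, 'k::comm_ring_1) mpoly"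
  where "X i = Poly_Mapping.single (Poly_Mapping.single i 1) 1"

text \<open>
  Exponents are natural numbers, so the subtraction below is truncated; it is only harmful where
  \<open>x_i\<close> does not occur in the monomial, and there the coefficient vanishes.
\<close>

definition partial_deriv :: "'n \<Rightarrow> ('n, 'k::comm_ring_1) mpoly_op"
  where "partial_deriv i p =
    (\<Sum>m\<in>Poly_Mapping.keys p.
      Poly_Mapping.single (m - Poly_Mapping.single i 1)
        (of_nat (Poly_Mapping.lookup m i) * Poly_Mapping.lookup p m))"

definition derivations :: "('n, 'k::comm_ring_1) mpoly_op set"
  where "derivations = {\<delta>.
    (\<forall>p q. \<delta> (p + q) = \<delta> p + \<delta> q) \<and>
    (\<forall>c p. \<delta> (Const c * p) = Const c * \<delta> p) \<and>
    (\<forall>p q. \<delta> (p * q) = \<delta> p * q + p * \<delta> q)}"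

definition scale :: "('n, 'k::comm_ring_1) mpoly \<Rightarrow> ('n, 'k) mpoly_op \<Rightarrow> ('n, 'k) mpoly_op"
    (infixr \<open>\<odot>\<close> 75)
  where "a \<odot> \<delta> = (\<lambda>p. a * \<delta> p)"

definition lie_bracket :: "('n, 'k::comm_ring_1) mpoly_op \<Rightarrow> ('n, 'k) mpoly_op \<Rightarrow> ('n, 'k) mpoly_op"
  where "lie_bracket \<delta> \<epsilon> = (\<lambda>p. \<delta> (\<epsilon> p) - \<epsilon> (\<delta> p))"

text \<open>
  The coefficient of \<open>\<partial>_i\<close> in a derivation \<open>\<delta> = \<Sum>i. a_i \<partial>_i\<close> is \<open>a_i = \<delta> x_i\<close>; see the lemmas
  \<open>derivations_eq\<close>, \<open>coefficients_unique\<close> and \<open>divergence_vector_field\<close> below.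
\<close>

definition divergence :: "('n::finite, 'k::comm_ring_1) mpoly_op \<Rightarrow> ('n, 'k) mpoly"
  where "divergence \<delta> = (\<Sum>i\<in>UNIV. partial_deriv i (\<delta> (X i)))"

definition div0 :: "('n::finite, 'k::comm_ring_1) mpoly_op set"
  where "div0 = {\<delta> \<in> derivations. divergence \<delta> = 0}"

definition lie_subalgebra :: "('n, 'k::comm_ring_1) mpoly_op set \<Rightarrow> bool"
  where "lie_subalgebra L \<longleftrightarrow>
    L \<subseteq> derivations \<and>
    (\<lambda>p. 0) \<in> L \<and>
    (\<forall>\<delta>\<in>L. \<forall>\<epsilon>\<in>L. (\<lambda>p. \<delta> p + \<epsilon> p) \<in> L) \<and>
    (\<forall>c. \<forall>\<delta>\<in>L. Const c \<odot> \<delta> \<in> L) \<and>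
    (\<forall>\<delta>\<in>L. \<forall>\<epsilon>\<in>L. lie_bracket \<delta> \<epsilon> \<in> L)"

definition lie_generates :: "('n, 'k::comm_ring_1) mpoly_op set \<Rightarrow> ('n, 'k) mpoly_op set \<Rightarrow> bool"
  where "lie_generates S L \<longleftrightarrow> lie_subalgebra hull S = L"

definition minimal_lie_generators ::
    "('n, 'k::comm_ring_1) mpoly_op set \<Rightarrow> ('n, 'k) mpoly_op set \<Rightarrow> bool"
  where "minimal_lie_generators S L \<longleftrightarrow>
    lie_generates S L \<and> (\<forall>T. T \<subset> S \<longrightarrow> \<not> lie_generates T L)"


subsection \<open>Agreement with the explicit description of derivations and divergence\<close>

lemma lookup_partial_deriv:
  "Poly_Mapping.lookup (partial_deriv i p) m =
    of_nat (Suc (Poly_Mapping.lookup m i)) * Poly_Mapping.lookup p (m + Poly_Mapping.single i 1)"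
proof -
  let ?e = "Poly_Mapping.single i (1::nat)"
  have eq: "(of_nat (Poly_Mapping.lookup k i) * Poly_Mapping.lookup p k when k - ?e = m)
      = (if k = m + ?e then of_nat (Suc (Poly_Mapping.lookup m i)) * Poly_Mapping.lookup p k else 0)" for k
  proof (cases "Poly_Mapping.lookup k i = 0")
    case True
    then have "k \<noteq> m + ?e" by (auto simp: lookup_add)
    with True show ?thesis by simp
  next
    case False
    then have "(k - ?e) + ?e = k"
      by (intro poly_mapping_eqI) (auto simp: lookup_add lookup_minus lookup_single when_def)
    then have "k - ?e = m \<longleftrightarrow> k = m + ?e" by auto
    then show ?thesis by (auto simp: lookup_add when_def)
  qed
  show ?thesis
    unfolding partial_deriv_def lookup_sum lookup_single eq
    by (auto simp: in_keys_iff)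
qed

lemma mpoly_induct [case_names zero single add]:
  fixes p :: "('n, 'k::comm_ring_1) mpoly"
  assumes "P 0" "\<And>m c. P (Poly_Mapping.single m c)" "\<And>p q. P p \<Longrightarrow> P q \<Longrightarrow> P (p + q)"
  shows "P p"
proof -
  have "P (\<Sum>m\<in>A. Poly_Mapping.single m (Poly_Mapping.lookup p m))" if "finite A" for A
    using that by (induction A) (auto intro: assms)
  moreover have "(\<Sum>m\<in>Poly_Mapping.keys p. Poly_Mapping.single m (Poly_Mapping.lookup p m)) = p"
    by (intro poly_mapping_eqI) (auto simp: lookup_sum lookup_single when_def in_keys_iff)
  ultimately show ?thesis by (metis finite_keys)
qed

lemma partial_deriv_add: "partial_deriv i (p + q) = partial_deriv i p + partial_deriv i q"
  by (intro poly_mapping_eqI) (simp add: lookup_partial_deriv lookup_add algebra_simps)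

lemma partial_deriv_zero: "partial_deriv i 0 = 0"
  by (intro poly_mapping_eqI) (simp add: lookup_partial_deriv)

lemma partial_deriv_single:
  "partial_deriv i (Poly_Mapping.single m c) =
    Poly_Mapping.single (m - Poly_Mapping.single i 1) (of_nat (Poly_Mapping.lookup m i) * c)"
  by (simp add: partial_deriv_def)

lemma partial_deriv_mult:
  "partial_deriv i (p * q) = partial_deriv i p * q + p * partial_deriv i q"
proof (induction p rule: mpoly_induct)
  case (single m c)
  show ?case
  proof (induction q rule: mpoly_induct)
    case (single m' c')
    let ?e = "Poly_Mapping.single i (1::nat)"
    have shift: "Poly_Mapping.single (k - ?e + k') (of_nat (Poly_Mapping.lookup k i) * d)
        = Poly_Mapping.single (k + k' - ?e) (of_nat (Poly_Mapping.lookup k i) * d)"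
      for k k' and d :: 'b
    proof (cases "Poly_Mapping.lookup k i = 0")
      case False
      then have "k - ?e + k' = k + k' - ?e"
        by (intro poly_mapping_eqI) (auto simp: lookup_add lookup_minus lookup_single when_def)
      then show ?thesis by simp
    qed simp
    show ?case
      using shift[of m m' "c * c'"] shift[of m' m "c * c'"]
      by (simp add: partial_deriv_single mult_single lookup_add distrib_right distrib_left single_add
          mult.assoc mult.left_commute add.commute)
  qed (simp_all add: partial_deriv_add partial_deriv_zero algebra_simps)
qed (simp_all add: partial_deriv_add partial_deriv_zero algebra_simps)

lemma partial_deriv_Const: "partial_deriv i (Const c) = 0"
  by (simp add: Const_def partial_deriv_single)

lemma partial_deriv_X: "partial_deriv i (X j) = (if i = j then 1 else 0)"
  by (auto simp: X_def partial_deriv_single lookup_single)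

lemma derivationsD:
  assumes "\<delta> \<in> derivations"
  shows "\<delta> (p + q) = \<delta> p + \<delta> q" "\<delta> (Const c * p) = Const c * \<delta> p"
    "\<delta> (p * q) = \<delta> p * q + p * \<delta> q" "\<delta> 0 = 0" "\<delta> 1 = 0" "\<delta> (p - q) = \<delta> p - \<delta> q"
    "\<delta> (Const c) = 0"
proof -
  show *: "\<delta> (p + q) = \<delta> p + \<delta> q" "\<delta> (Const c * p) = Const c * \<delta> p"
    "\<delta> (p * q) = \<delta> p * q + p * \<delta> q" for p q c
    using assms by (auto simp: derivations_def)
  show "\<delta> 0 = 0" using *(1)[of 0 0] by simp
  show one: "\<delta> 1 = 0" using *(3)[of 1 1] by simp
  show "\<delta> (Const c) = 0" using *(2)[of c 1] one by simp
  show "\<delta> (p - q) = \<delta> p - \<delta> q" using *(1)[of "p - q" q] by (simp add: algebra_simps)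
qed

lemma vector_field_derivation:
  fixes a :: "'n::finite \<Rightarrow> ('n, 'k::comm_ring_1) mpoly"
  shows "(\<lambda>p. \<Sum>i\<in>UNIV. a i * partial_deriv i p) \<in> derivations"
  unfolding derivations_def
  by (simp add: partial_deriv_add partial_deriv_mult partial_deriv_Const sum.distrib
      distrib_left sum_distrib_left mult.assoc mult.left_commute sum_distrib_right)

lemma partial_deriv_derivation: "partial_deriv i \<in> derivations"
  by (auto simp: derivations_def partial_deriv_add partial_deriv_mult partial_deriv_Const)

lemma vector_field_X:
  fixes a :: "'n::finite \<Rightarrow> ('n, 'k::comm_ring_1) mpoly"
  shows "(\<Sum>i\<in>UNIV. a i * partial_deriv i (X j)) = a j"
  by (simp add: partial_deriv_X if_distrib cong: if_cong)

lemma derivation_expand: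
  fixes \<delta> :: "('n::finite, 'k::comm_ring_1) mpoly_op"
  assumes "\<delta> \<in> derivations"
  shows "\<delta> = (\<lambda>p. \<Sum>i\<in>UNIV. \<delta> (X i) * partial_deriv i p)"
proof -
  let ?v = "\<lambda>p. \<Sum>i\<in>UNIV. \<delta> (X i) * partial_deriv i p"
  note v = derivationsD[OF vector_field_derivation[of "\<lambda>i. \<delta> (X i)"]]
  note d = derivationsD[OF assms]
  have mon: "\<delta> (Poly_Mapping.single m 1) = ?v (Poly_Mapping.single m 1)" for m :: "'n \<Rightarrow>\<^sub>0 nat"
  proof (induction "\<Sum>i\<in>UNIV. Poly_Mapping.lookup m i" arbitrary: m)
    case 0
    then have "m = 0" by (intro poly_mapping_eqI) simp
    then show ?case using d(5) v(5) by simp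
  next
    case (Suc k)
    then obtain i where i: "Poly_Mapping.lookup m i \<noteq> 0"
      by (metis Zero_not_Suc sum.neutral)
    define m' where "m' = m - Poly_Mapping.single i 1"
    have m: "m = Poly_Mapping.single i 1 + m'"
      using i by (intro poly_mapping_eqI)
        (auto simp: m'_def lookup_add lookup_minus lookup_single when_def)
    have "k = (\<Sum>i\<in>UNIV. Poly_Mapping.lookup m' i)"
      using Suc(2) unfolding m by (simp add: lookup_add sum.distrib lookup_single when_def)
    then have IH: "\<delta> (Poly_Mapping.single m' 1) = ?v (Poly_Mapping.single m' 1)"
      by (rule Suc(1))
    have s: "Poly_Mapping.single m 1 = X i * Poly_Mapping.single m' (1::'k)"
      by (simp add: X_def mult_single m)
    show ?case unfolding s d(3) v(3) IH vector_field_X ..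
  qed
  have "\<delta> p = ?v p" for p
  proof (induction p rule: mpoly_induct)
    case (single m c)
    have s: "Poly_Mapping.single m c = Const c * Poly_Mapping.single m 1"
      by (simp add: Const_def mult_single)
    show ?case unfolding s d(2) v(2) mon ..
  next
    case (add p q)
    then show ?case unfolding d(1) v(1) by simp
  qed (use d(4) v(4) in simp)
  then show ?thesis by blast
qed

lemma derivations_eq:
  "(derivations :: ('n::finite, 'k::comm_ring_1) mpoly_op set) =
    {\<lambda>p. \<Sum>i\<in>UNIV. a i * partial_deriv i p | a. True}"
proof (intro equalityI subsetI)
  fix \<delta> :: "('n, 'k) mpoly_op"
  assume "\<delta> \<in> derivations"
  then show "\<delta> \<in> {\<lambda>p. \<Sum>i\<in>UNIV. a i * partial_deriv i p | a. True}"
    unfolding mem_Collect_eq by (intro exI conjI TrueI) (rule derivation_expand)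
qed (auto simp: vector_field_derivation)

lemma coefficients_unique:
  fixes a b :: "'n::finite \<Rightarrow> ('n, 'k::comm_ring_1) mpoly"
  assumes "(\<lambda>p. \<Sum>i\<in>UNIV. a i * partial_deriv i p) = (\<lambda>p. \<Sum>i\<in>UNIV. b i * partial_deriv i p)"
  shows "a = b"
proof
  fix j
  show "a j = b j" using fun_cong[OF assms, of "X j"] unfolding vector_field_X .
qed

lemma divergence_vector_field:
  "divergence (\<lambda>p. \<Sum>i\<in>UNIV. a i * partial_deriv i p) = (\<Sum>i\<in>UNIV. partial_deriv i (a i))"
  by (simp add: divergence_def vector_field_X)

lemma lie_bracket_derivation:
  assumes "\<delta> \<in> derivations" "\<epsilon> \<in> derivations"
  shows "lie_bracket \<delta> \<epsilon> \<in> derivations"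
proof -
  note d = derivationsD[OF assms(1)] and e = derivationsD[OF assms(2)]
  show ?thesis
    unfolding lie_bracket_def derivations_def mem_Collect_eq
    by (intro conjI allI; simp only: d(1-3) e(1-3))
      (simp_all add: d(4,7) e(4,7) algebra_simps)
qed

lemma partial_deriv_commute:
  "partial_deriv i (partial_deriv j p) = partial_deriv j (partial_deriv i p)"
proof (cases "i = j")
  case False
  have "m + Poly_Mapping.single i 1 + Poly_Mapping.single j 1 =
      m + Poly_Mapping.single j 1 + Poly_Mapping.single i 1" for m :: "'a \<Rightarrow>\<^sub>0 nat"
    by (simp add: ac_simps)
  with False show ?thesis
    by (intro poly_mapping_eqI)
      (simp add: lookup_partial_deriv lookup_add lookup_single_not_eq mult.left_commute
        del: of_nat_Suc)
qed simp

lemma divergence_lie_bracket: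
  fixes \<delta> \<epsilon> :: "('n::finite, 'k::comm_ring_1) mpoly_op"
  assumes "\<delta> \<in> derivations" "\<epsilon> \<in> derivations"
  shows "divergence (lie_bracket \<delta> \<epsilon>) = \<delta> (divergence \<epsilon>) - \<epsilon> (divergence \<delta>)"
proof -
  define a where "a i = \<delta> (X i)" for i
  define b where "b i = \<epsilon> (X i)" for i
  have d: "\<delta> p = (\<Sum>i\<in>UNIV. a i * partial_deriv i p)" for p
    using derivation_expand[OF assms(1)] unfolding a_def by metis
  have e: "\<epsilon> p = (\<Sum>i\<in>UNIV. b i * partial_deriv i p)" for p
    using derivation_expand[OF assms(2)] unfolding b_def by metis
  note pd = derivationsD[OF partial_deriv_derivation]
  have pd_sum: "partial_deriv i (sum f A) = (\<Sum>j\<in>A. partial_deriv i (f j))"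
    if "finite A" for i A and f :: "'n \<Rightarrow> ('n, 'k) mpoly"
    using that by (induction A) (auto simp: pd)
  have comm: "(\<Sum>i\<in>UNIV. \<Sum>j\<in>UNIV. partial_deriv i (a j) * partial_deriv j (b i))
      = (\<Sum>i\<in>UNIV. \<Sum>j\<in>UNIV. partial_deriv i (b j) * partial_deriv j (a i))"
    by (subst sum.swap) (simp add: mult.commute)
  have swap: "(\<Sum>i\<in>UNIV. \<Sum>j\<in>UNIV. f j * partial_deriv i (partial_deriv j (g i)))
      = (\<Sum>j\<in>UNIV. f j * partial_deriv j (\<Sum>i\<in>UNIV. partial_deriv i (g i)))"
    for f g :: "'n \<Rightarrow> ('n, 'k) mpoly"
    by (subst sum.swap) (simp add: pd_sum sum_distrib_left partial_deriv_commute)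
  have "divergence (lie_bracket \<delta> \<epsilon>) =
      (\<Sum>i\<in>UNIV. partial_deriv i (\<Sum>j\<in>UNIV. a j * partial_deriv j (b i)) -
        partial_deriv i (\<Sum>j\<in>UNIV. b j * partial_deriv j (a i)))"
    unfolding divergence_def lie_bracket_def pd(6) a_def[symmetric] b_def[symmetric]
    by (simp add: d[of "b _"] e[of "a _"])
  also have "\<dots> = (\<Sum>i\<in>UNIV. \<Sum>j\<in>UNIV. a j * partial_deriv i (partial_deriv j (b i)))
      - (\<Sum>i\<in>UNIV. \<Sum>j\<in>UNIV. b j * partial_deriv i (partial_deriv j (a i)))"
    using comm by (simp add: pd_sum pd(3) sum.distrib sum_subtractf)
  also have "\<dots> = \<delta> (divergence \<epsilon>) - \<epsilon> (divergence \<delta>)"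
    unfolding swap divergence_def a_def[symmetric] b_def[symmetric]
    by (simp add: d[of "sum _ _"] e[of "sum _ _"])
  finally show ?thesis .
qed

lemma lie_subalgebra_derivations: "lie_subalgebra derivations"
proof -
  have "(\<lambda>p. 0) \<in> derivations" by (simp add: derivations_def)
  moreover have "(\<lambda>p. \<delta> p + \<epsilon> p) \<in> derivations"
    if "\<delta> \<in> derivations" "\<epsilon> \<in> derivations" for \<delta> \<epsilon> :: "('n, 'k::comm_ring_1) mpoly_op"
    unfolding derivations_def mem_Collect_eq
    by (auto simp: derivationsD[OF that(1)] derivationsD[OF that(2)] algebra_simps)
  moreover have "Const c \<odot> \<delta> \<in> derivations"
    if "\<delta> \<in> derivations" for c and \<delta> :: "('n, 'k::comm_ring_1) mpoly_op"
    unfolding derivations_def scale_def mem_Collect_eq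
    by (intro conjI allI; simp only: derivationsD(1-3)[OF that])
      (simp_all add: derivationsD(7)[OF that] algebra_simps)
  ultimately show ?thesis
    by (auto simp: lie_subalgebra_def lie_bracket_derivation)
qed

lemma lie_subalgebra_div0: "lie_subalgebra (div0 :: ('n::finite, 'k::comm_ring_1) mpoly_op set)"
proof -
  note pd = derivationsD[OF partial_deriv_derivation]
  have "divergence (\<lambda>p. 0 :: ('n, 'k) mpoly) = 0"
    by (simp add: divergence_def pd)
  moreover have "divergence (\<lambda>p. \<delta> p + \<epsilon> p) = divergence \<delta> + divergence \<epsilon>"
    for \<delta> \<epsilon> :: "('n, 'k) mpoly_op"
    by (simp add: divergence_def pd sum.distrib)
  moreover have "divergence (Const c \<odot> \<delta>) = Const c * divergence \<delta>"
    for c and \<delta> :: "('n, 'k) mpoly_op"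
    unfolding divergence_def scale_def pd(2) sum_distrib_left ..
  moreover have "divergence (lie_bracket \<delta> \<epsilon>) = 0" if "\<delta> \<in> div0" "\<epsilon> \<in> div0"
    for \<delta> \<epsilon> :: "('n, 'k) mpoly_op"
    using that by (simp add: div0_def divergence_lie_bracket derivationsD(4))
  ultimately show ?thesis
    using lie_subalgebra_derivations[where 'a = 'n and 'b = 'k]
    unfolding lie_subalgebra_def by (auto simp: div0_def)
qed

end

theory Submission
  imports Defs
begin

text \<open>
  Write \<open>z = e 1\<close>. Antidifferentiation in \<open>x_z\<close> shows that \<open>div0\<close> is the sum over \<open>i \<noteq> z\<close> of the spaces
  of Hamiltonian fields \<open>\<partial>_z(f) \<partial>_i - \<partial>_i(f) \<partial>_z\<close> in the planes \<open>(x_i, x_z)\<close>, the other variables being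
  parameters. If \<open>L\<close> contains the generators, the Hamiltonians \<open>f\<close> whose field lies in \<open>L\<close> form a Poisson
  algebra containing \<open>x_z^3\<close> and \<open>x_i^3\<close>; bracketing with these two raises the degree by one and yields
  all monomials in \<open>x_z, x_i\<close>. It is also stable under \<open>x_k \<partial>_z\<close> for \<open>k \<notin> {i, z}\<close>, which
  introduces the remaining variables.

  For minimality, each generator moves a subspace of polynomials which all other generators stabilise:
  the maximal ideal at the origin for \<open>\<partial>_z\<close>, the polynomials free of \<open>x_i\<close> for \<open>x_i^2 \<partial>_z\<close>,
  and \<open>K[x_i]\<close> for \<open>x_z^2 \<partial>_i\<close>.
\<close>

section \<open>Calculus of partial derivatives, constants and monomials\<close>

lemmas pd_simps = derivationsD[OF partial_deriv_derivation]

lemma partial_deriv_minus: "partial_deriv i (- p) = - partial_deriv i p"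
  using pd_simps(6)[of i 0 p] by (simp add: pd_simps(4))

lemma partial_deriv_sum: "partial_deriv i (sum f A) = (\<Sum>a\<in>A. partial_deriv i (f a))"
  by (induction A rule: infinite_finite_induct) (simp_all add: pd_simps)

text \<open>At \<open>n = 0\<close> the truncated exponent is harmless, because the factor
  \<open>of_nat n\<close> vanishes.\<close>

lemma partial_deriv_power: "partial_deriv i (p ^ n) = of_nat n * p ^ (n - 1) * partial_deriv i p"
proof (induction n)
  case (Suc n)
  then show ?case by (cases n) (simp_all add: pd_simps algebra_simps)
qed (simp add: pd_simps)

text \<open>Scalars act through \<open>Const\<close>, whereas differentiating powers produces
  factors \<open>of_nat n\<close>; this links the two.\<close>

lemma Const_of_nat: "Const (of_nat n :: 'k::comm_ring_1) = of_nat n"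
proof (induction n)
  case (Suc n)
  have "Const (1 + of_nat n :: 'k) = Const 1 + Const (of_nat n)"
    by (simp add: Const_def single_add)
  then show ?case using Suc by (simp add: Const_def)
qed (simp add: Const_def)

lemma Const_mult_Const: "Const a * Const b = Const (a * b)"
  by (simp add: Const_def mult_single)

lemma Const_1: "Const 1 = 1"
  by (simp add: Const_def)

lemma Const_uminus_1: "Const (-1) = -1"
  by (simp add: Const_def single_uminus)

lemma Const_mult_X_eq_0: "Const c * X i = 0 \<longleftrightarrow> c = 0"
  unfolding Const_def X_def mult_single
  by (metis add_0 mult_1_right lookup_single_eq lookup_zero single_zero)

lemma X_power: "X i ^ n = Poly_Mapping.single (Poly_Mapping.single i n) 1"
  by (induction n) (simp_all add: X_def mult_single single_add[symmetric])

lemma prod_single: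
  "(\<Prod>i\<in>A. Poly_Mapping.single (f i) 1) = Poly_Mapping.single (\<Sum>i\<in>A. f i) 1"
  by (induction A rule: infinite_finite_induct) (simp_all add: mult_single)

lemma single_eq_prod_X:
  fixes m :: "'n::finite \<Rightarrow>\<^sub>0 nat"
  shows "Poly_Mapping.single m c = Const c * (\<Prod>i\<in>UNIV. X i ^ Poly_Mapping.lookup m i)"
proof -
  have "(\<Sum>i\<in>UNIV. Poly_Mapping.single i (Poly_Mapping.lookup m i)) = m"
    by (intro poly_mapping_eqI) (simp add: lookup_sum lookup_single when_def)
  then show ?thesis
    by (simp add: X_power prod_single Const_def mult_single)
qed

text \<open>Termwise integration, dividing by positive integers. If
  \<open>partial_deriv j p = 0\<close>, characteristic zero forbids monomials of \<open>p\<close>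
  involving \<open>x_j\<close>, and raising the exponent of \<open>x_i\<close> introduces
  none.\<close>

lemma antiderivative_exists:
  fixes p :: "('n, 'k::field_char_0) mpoly"
  obtains q where "partial_deriv i q = p"
    "\<And>j. j \<noteq> i \<Longrightarrow> partial_deriv j p = 0 \<Longrightarrow> partial_deriv j q = 0"
proof
  let ?e = "\<lambda>i. Poly_Mapping.single i (1::nat)"
  define q where "q = (\<Sum>m\<in>Poly_Mapping.keys p. Poly_Mapping.single (m + ?e i)
    (Poly_Mapping.lookup p m / of_nat (Suc (Poly_Mapping.lookup m i))))"
  have "partial_deriv i q = (\<Sum>m\<in>Poly_Mapping.keys p. Poly_Mapping.single m (Poly_Mapping.lookup p m))"
    unfolding q_def partial_deriv_sum partial_deriv_single
    by (intro sum.cong refl) (simp add: lookup_add del: of_nat_Suc)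
  also have "\<dots> = p"
    by (intro poly_mapping_eqI) (auto simp: lookup_sum lookup_single when_def in_keys_iff)
  finally show "partial_deriv i q = p" .
  fix j assume j: "j \<noteq> i" "partial_deriv j p = 0"
  have zero: "Poly_Mapping.lookup m j = 0" if "m \<in> Poly_Mapping.keys p" for m
  proof (rule ccontr)
    assume *: "Poly_Mapping.lookup m j \<noteq> 0"
    then have "m - ?e j + ?e j = m"
      by (intro poly_mapping_eqI) (auto simp: lookup_add lookup_minus lookup_single when_def)
    then have "Poly_Mapping.lookup p m = 0"
      using lookup_partial_deriv[of j p "m - ?e j"] j(2) by (simp del: of_nat_Suc)
    then show False using that by (simp add: in_keys_iff)
  qed
  show "partial_deriv j q = 0"
    unfolding q_def partial_deriv_sum partial_deriv_single
    by (intro sum.neutral ballI) (use j(1) in \<open>simp add: lookup_add zero lookup_single\<close>)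
qed


section \<open>Hamiltonian vector fields\<close>

text \<open>Applied to a polynomial \<open>g\<close>, this operator is also the Poisson bracket of
  \<open>f\<close> and \<open>g\<close> in the variables \<open>x_i\<close>, \<open>x_j\<close>, so
  one constant serves for both fields and brackets.\<close>

definition hamiltonian :: "'n \<Rightarrow> 'n \<Rightarrow> ('n, 'k::comm_ring_1) mpoly \<Rightarrow> ('n, 'k) mpoly_op"
  where "hamiltonian i j f = (\<lambda>p. partial_deriv j f * partial_deriv i p - partial_deriv i f * partial_deriv j p)"

text \<open>This is the Jacobi identity of the Poisson bracket.\<close>

lemma hamiltonian_bracket:
  "lie_bracket (hamiltonian i j f) (hamiltonian i j g) = hamiltonian i j (hamiltonian i j f g)"
  by (rule ext) (simp add: lie_bracket_def hamiltonian_def pd_simps partial_deriv_commute algebra_simps)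

text \<open>Since \<open>a\<close> is free of \<open>x_i\<close> and \<open>x_j\<close>, the field
  commutes with both partial derivatives and thus acts as a derivation of the Poisson
  bracket.\<close>

lemma hamiltonian_bracket_field:
  assumes "partial_deriv i a = 0" "partial_deriv j a = 0"
  shows "lie_bracket (a \<odot> partial_deriv l) (hamiltonian i j f) = hamiltonian i j (a * partial_deriv l f)"
  by (rule ext)
    (simp add: lie_bracket_def scale_def hamiltonian_def pd_simps assms partial_deriv_commute algebra_simps)

lemma hamiltonian_add:
  "hamiltonian i j (f + g) = (\<lambda>p. hamiltonian i j f p + hamiltonian i j g p)"
  by (rule ext) (simp add: hamiltonian_def pd_simps algebra_simps)

lemma hamiltonian_Const: "hamiltonian i j (Const c * f) = Const c \<odot> hamiltonian i j f"
  by (rule ext) (simp add: hamiltonian_def scale_def pd_simps algebra_simps)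

section \<open>Closure rules for Lie subalgebras\<close>

lemma lie_subalgebraD:
  assumes "lie_subalgebra L"
  shows "(\<lambda>p. 0) \<in> L"
    "\<delta> \<in> L \<Longrightarrow> \<epsilon> \<in> L \<Longrightarrow> (\<lambda>p. \<delta> p + \<epsilon> p) \<in> L"
    "\<delta> \<in> L \<Longrightarrow> Const c \<odot> \<delta> \<in> L"
    "\<delta> \<in> L \<Longrightarrow> \<epsilon> \<in> L \<Longrightarrow> lie_bracket \<delta> \<epsilon> \<in> L"
  using assms unfolding lie_subalgebra_def by auto

lemma lie_subalgebra_sum:
  assumes "lie_subalgebra L" "\<And>i. i \<in> A \<Longrightarrow> \<delta> i \<in> L"
  shows "(\<lambda>p. \<Sum>i\<in>A. \<delta> i p) \<in> L"
  using assms(2)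
  by (induction A rule: infinite_finite_induct) (simp_all add: lie_subalgebraD[OF assms(1)])

lemma lie_subalgebra_of_nat_cancel:
  fixes L :: "('n, 'k::field_char_0) mpoly_op set"
  assumes "lie_subalgebra L" "of_nat n \<odot> \<delta> \<in> L" "n > 0"
  shows "\<delta> \<in> L"
proof -
  have "Const (1 / of_nat n) \<odot> of_nat n \<odot> \<delta> \<in> L"
    using assms by (intro lie_subalgebraD(3))
  moreover have "Const (1 / of_nat n) \<odot> of_nat n \<odot> \<delta> = \<delta>"
    using \<open>n > 0\<close> unfolding Const_of_nat[symmetric] scale_def
    by (simp add: mult.assoc[symmetric] Const_mult_Const Const_1)
  ultimately show ?thesis by simp
qed

lemma lie_subalgebra_uminus:
  assumes "lie_subalgebra L" "\<delta> \<in> L"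
  shows "(\<lambda>p. - \<delta> p) \<in> L"
  using lie_subalgebraD(3)[OF assms, of "-1"] by (simp add: Const_uminus_1 scale_def)


section \<open>Generation\<close>

context
  fixes L :: "('n::finite, 'k::field_char_0) mpoly_op set" and z :: 'n
  assumes L: "lie_subalgebra L"
    and dz: "partial_deriv z \<in> L"
    and sq_dz: "\<And>i. i \<noteq> z \<Longrightarrow> X i ^ 2 \<odot> partial_deriv z \<in> L"
    and sq_di: "\<And>i. i \<noteq> z \<Longrightarrow> X z ^ 2 \<odot> partial_deriv i \<in> L"
begin

definition hams :: "'n \<Rightarrow> ('n, 'k) mpoly set"
  where "hams i = {f. hamiltonian i z f \<in> L}"

lemma hams_add: "f \<in> hams i \<Longrightarrow> g \<in> hams i \<Longrightarrow> f + g \<in> hams i"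
  by (simp add: hams_def hamiltonian_add lie_subalgebraD[OF L])

lemma hams_Const: "f \<in> hams i \<Longrightarrow> Const c * f \<in> hams i"
  by (simp add: hams_def hamiltonian_Const lie_subalgebraD[OF L])

lemma hams_uminus: "- f \<in> hams i \<longleftrightarrow> f \<in> hams i"
  using hams_Const[of f i "-1"] hams_Const[of "- f" i "-1"] by (auto simp: Const_uminus_1)

lemma hams_of_nat_cancel: "of_nat n * f \<in> hams i \<Longrightarrow> n > 0 \<Longrightarrow> f \<in> hams i"
  unfolding hams_def mem_Collect_eq Const_of_nat[symmetric] hamiltonian_Const
  unfolding Const_of_nat by (rule lie_subalgebra_of_nat_cancel[OF L])

lemma hams_hamiltonian: "f \<in> hams i \<Longrightarrow> g \<in> hams i \<Longrightarrow> hamiltonian i z f g \<in> hams i"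
  by (simp add: hams_def hamiltonian_bracket[symmetric] lie_subalgebraD[OF L])

lemma hams_field:
  assumes "a \<odot> partial_deriv l \<in> L" "partial_deriv i a = 0" "partial_deriv z a = 0" "f \<in> hams i"
  shows "a * partial_deriv l f \<in> hams i"
  using assms by (simp add: hams_def hamiltonian_bracket_field[symmetric] lie_subalgebraD[OF L])

lemma hams_partial_deriv: "f \<in> hams i \<Longrightarrow> partial_deriv z f \<in> hams i"
  using hams_field[of 1 z i f] dz by (simp add: scale_def pd_simps)

text \<open>Up to the factor 3, the quadratic generators are themselves Hamiltonian fields, of
  \<open>X z ^ 3\<close> and \<open>- (X i ^ 3)\<close>.\<close>

lemma cubes_in_hams:
  assumes "i \<noteq> z"
  shows "X z ^ 3 \<in> hams i" "X i ^ 3 \<in> hams i"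
proof -
  have "hamiltonian i z (X z ^ 3) = Const 3 \<odot> (X z ^ 2 \<odot> (partial_deriv i :: ('n, 'k) mpoly_op))"
    using assms Const_of_nat[of 3, where 'k = 'k and 'a = 'n]
    by (intro ext) (simp add: hamiltonian_def scale_def partial_deriv_power partial_deriv_X)
  then show "X z ^ 3 \<in> hams i"
    by (simp add: hams_def lie_subalgebraD[OF L] sq_di assms)
  have "hamiltonian i z (- (X i ^ 3)) = Const 3 \<odot> (X i ^ 2 \<odot> (partial_deriv z :: ('n, 'k) mpoly_op))"
    using assms Const_of_nat[of 3, where 'k = 'k and 'a = 'n]
    by (intro ext)
      (simp add: hamiltonian_def scale_def partial_deriv_power partial_deriv_X partial_deriv_minus)
  then have "- (X i ^ 3) \<in> hams i"
    by (simp add: hams_def lie_subalgebraD[OF L] sq_dz assms)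
  then show "X i ^ 3 \<in> hams i"
    by (simp only: hams_uminus)
qed

text \<open>Bracketing with \<open>partial_deriv z\<close> differentiates Hamiltonians along
  \<open>x_z\<close>, bringing \<open>X z ^ 3\<close> down to lower powers; \<open>- X i\<close> is
  a Hamiltonian of \<open>partial_deriv z\<close> itself.\<close>

lemma variables_in_hams:
  assumes "i \<noteq> z"
  shows "X z \<in> hams i" "X z ^ 2 \<in> hams i" "X i \<in> hams i"
proof -
  have "of_nat 3 * X z ^ 2 \<in> hams i"
    using hams_partial_deriv[OF cubes_in_hams(1)[OF assms]]
    by (simp add: partial_deriv_power partial_deriv_X)
  then show sq: "X z ^ 2 \<in> hams i"
    by (rule hams_of_nat_cancel) simp
  have "of_nat 2 * X z \<in> hams i"
    using hams_partial_deriv[OF sq] by (simp add: partial_deriv_power partial_deriv_X)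
  then show "X z \<in> hams i"
    by (rule hams_of_nat_cancel) simp
  have "hamiltonian i z (- X i) = (partial_deriv z :: ('n, 'k) mpoly_op)"
    using assms by (intro ext) (simp add: hamiltonian_def partial_deriv_X partial_deriv_minus)
  then have "- X i \<in> hams i"
    using dz by (simp add: hams_def)
  then show "X i \<in> hams i"
    by (simp only: hams_uminus)
qed

lemma partial_deriv_in: "partial_deriv i \<in> L"
proof (cases "i = z")
  case False
  then have "hamiltonian i z (X z :: ('n, 'k) mpoly) = partial_deriv i"
    by (intro ext) (simp add: hamiltonian_def partial_deriv_X)
  then show ?thesis
    using variables_in_hams(1)[OF False] by (simp add: hams_def)
qed (simp add: dz)

text \<open>Bracketing with \<open>partial_deriv k\<close> lowers the quadratic generator. The
  linear field will trade one factor \<open>x_z\<close> of a Hamiltonian for a factor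
  \<open>x_k\<close>.\<close>

lemma linear_dz_in:
  assumes "k \<noteq> z"
  shows "X k \<odot> partial_deriv z \<in> L"
proof -
  have "lie_bracket (partial_deriv k) (X k ^ 2 \<odot> partial_deriv z) =
      of_nat 2 \<odot> X k \<odot> (partial_deriv z :: ('n, 'k) mpoly_op)"
    by (rule ext) (simp add: lie_bracket_def scale_def pd_simps partial_deriv_power partial_deriv_X
        partial_deriv_commute[of k z] algebra_simps)
  moreover have "lie_bracket (partial_deriv k) (X k ^ 2 \<odot> partial_deriv z) \<in> L"
    by (intro lie_subalgebraD[OF L] partial_deriv_in sq_dz assms)
  ultimately have "of_nat 2 \<odot> X k \<odot> partial_deriv z \<in> L"
    by (simp only:)
  then show ?thesis
    by (rule lie_subalgebra_of_nat_cancel[OF L]) simp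
qed

text \<open>Induction on the total degree: for \<open>a \<ge> 2\<close>, bracketing
  \<open>X z ^ 3\<close> with \<open>X z ^ (a - 2) * X i ^ (b + 1)\<close>, of degree one less,
  gives a nonzero multiple of the target; \<open>X i ^ 3\<close> does the same for
  \<open>b \<ge> 2\<close>.\<close>

lemma planar_monomial_in_hams:
  assumes "i \<noteq> z"
  shows "X z ^ a * X i ^ b \<in> hams i"
proof (induction "a + b" arbitrary: a b rule: less_induct)
  case less
  note ham = hamiltonian_def partial_deriv_power partial_deriv_X partial_deriv_mult
  consider (z) "a \<ge> 2" | (i) "b \<ge> 2" | (small) "a \<le> 1" "b \<le> 1"
    by linarith
  then show ?case
  proof cases
    case z
    then obtain a' where a: "a = Suc (Suc a')" by (auto simp: numeral_2_eq_2 le_iff_add)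
    have "hamiltonian i z (X z ^ 3) (X z ^ a' * X i ^ Suc b) \<in> hams i"
      by (intro hams_hamiltonian cubes_in_hams less assms) (simp add: a)
    moreover have "hamiltonian i z (X z ^ 3) (X z ^ a' * X i ^ Suc b) =
        (of_nat (3 * Suc b) * (X z ^ a * X i ^ b) :: ('n, 'k) mpoly)"
      using assms by (simp add: ham a del: power_Suc of_nat_Suc)
        (simp add: power2_eq_square algebra_simps)
    ultimately have "of_nat (3 * Suc b) * (X z ^ a * X i ^ b) \<in> hams i"
      by (simp only:)
    then show ?thesis
      by (rule hams_of_nat_cancel) simp
  next
    case i
    then obtain b' where b: "b = Suc (Suc b')" by (auto simp: numeral_2_eq_2 le_iff_add)
    have "hamiltonian i z (X i ^ 3) (X z ^ Suc a * X i ^ b') \<in> hams i"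
      by (intro hams_hamiltonian cubes_in_hams less assms) (simp add: b)
    moreover have "hamiltonian i z (X i ^ 3) (X z ^ Suc a * X i ^ b') =
        - (of_nat (3 * Suc a) * (X z ^ a * X i ^ b) :: ('n, 'k) mpoly)"
      using assms by (simp add: ham b del: power_Suc of_nat_Suc)
        (simp add: power2_eq_square algebra_simps)
    ultimately have "of_nat (3 * Suc a) * (X z ^ a * X i ^ b) \<in> hams i"
      by (simp only: hams_uminus)
    then show ?thesis
      by (rule hams_of_nat_cancel) simp
  next
    case small
    have one: "1 \<in> hams i"
      using lie_subalgebraD(1)[OF L] by (simp add: hams_def hamiltonian_def pd_simps)
    \<comment> \<open>Among the remaining monomials only \<open>X z * X i\<close> is new. It arises
      from bracketing the two squares, and \<open>X i ^ 2\<close> in turn from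
      \<open>X i ^ 3\<close> and \<open>X z\<close>.\<close>
    have "hamiltonian i z (X i ^ 3) (X z) \<in> hams i"
      by (intro hams_hamiltonian cubes_in_hams variables_in_hams assms)
    moreover have "hamiltonian i z (X i ^ 3) (X z) = - (of_nat 3 * X i ^ 2 :: ('n, 'k) mpoly)"
      using assms by (simp add: ham)
    ultimately have "of_nat 3 * X i ^ 2 \<in> hams i"
      by (simp only: hams_uminus)
    then have "X i ^ 2 \<in> hams i"
      by (rule hams_of_nat_cancel) simp
    then have "hamiltonian i z (X z ^ 2) (X i ^ 2) \<in> hams i"
      by (intro hams_hamiltonian variables_in_hams assms)
    moreover have "hamiltonian i z (X z ^ 2) (X i ^ 2) = (of_nat 4 * (X z * X i) :: ('n, 'k) mpoly)"
      using assms by (simp add: ham)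
    ultimately have "of_nat 4 * (X z * X i) \<in> hams i"
      by simp
    then have "X z * X i \<in> hams i"
      by (rule hams_of_nat_cancel) simp
    with one variables_in_hams[OF assms] show ?thesis
      using small by (auto simp: le_Suc_eq)
  qed
qed

text \<open>Each new factor \<open>x_k\<close> costs one factor \<open>x_z\<close>, because
  \<open>q\<close> is free of \<open>x_z\<close> and the derivative hits only the power of
  \<open>x_z\<close>. Hence all exponents \<open>a\<close> are needed in the hypothesis and in the
  induction.\<close>

lemma hams_times_variable:
  assumes "k \<noteq> z" "k \<noteq> i" "partial_deriv z q = 0" "\<And>a. X z ^ a * q \<in> hams i"
  shows "X z ^ a * (X k ^ n * q) \<in> hams i"
  using assms(4)
proof (induction n arbitrary: a)
  case (Suc n)
  have "X k * partial_deriv z (X z ^ Suc a * (X k ^ n * q)) \<in> hams i"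
    using assms by (intro hams_field linear_dz_in Suc) (auto simp: partial_deriv_X)
  moreover have "X k * partial_deriv z (X z ^ Suc a * (X k ^ n * q)) =
      of_nat (Suc a) * (X z ^ a * (X k ^ Suc n * q))"
    using assms(1,3)
    by (simp add: partial_deriv_mult partial_deriv_power partial_deriv_X del: power_Suc of_nat_Suc)
      (simp add: algebra_simps)
  ultimately have "of_nat (Suc a) * (X z ^ a * (X k ^ Suc n * q)) \<in> hams i"
    by (simp only:)
  then show ?case
    by (rule hams_of_nat_cancel) simp
qed simp

lemma hams_eq_UNIV:
  assumes "i \<noteq> z"
  shows "f \<in> hams i"
proof (induction f rule: mpoly_induct)
  case (single m c)
  let ?f = "Poly_Mapping.lookup m"
  \<comment> \<open>Variables outside the plane are adjoined one at a time. Freeness from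
    \<open>x_z\<close> and the range over all \<open>a\<close> are carried along to feed
    \<open>hams_times_variable\<close>.\<close>
  have "partial_deriv z ((\<Prod>k\<in>A. X k ^ ?f k) * X i ^ ?f i :: ('n, 'k) mpoly) = 0 \<and>
      (\<forall>a. X z ^ a * ((\<Prod>k\<in>A. X k ^ ?f k) * X i ^ ?f i) \<in> hams i)"
    if "finite A" "A \<subseteq> UNIV - {i, z}" for A
    using that
  proof (induction A)
    case empty
    then show ?case
      using assms planar_monomial_in_hams[OF assms]
      by (auto simp: partial_deriv_power partial_deriv_X)
  next
    case (insert k A)
    let ?q = "(\<Prod>k\<in>A. X k ^ ?f k) * X i ^ ?f i :: ('n, 'k) mpoly"
    have k: "k \<noteq> z" "k \<noteq> i" and q: "partial_deriv z ?q = 0" "X z ^ a * ?q \<in> hams i" for a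
      using insert by auto
    have "partial_deriv z (X k ^ ?f k * ?q) = 0"
      using k by (subst partial_deriv_mult) (simp add: q partial_deriv_power partial_deriv_X)
    moreover have "X z ^ a * (X k ^ ?f k * ?q) \<in> hams i" for a
      by (intro hams_times_variable k q)
    ultimately show ?case
      using insert(1,2) by (simp add: mult.assoc)
  qed
  from this[of "UNIV - {i, z}"]
  have "X z ^ ?f z * ((\<Prod>k\<in>UNIV - {i, z}. X k ^ ?f k) * X i ^ ?f i) \<in> hams i"
    by simp
  moreover have "(\<Prod>k\<in>UNIV. X k ^ ?f k) =
      X z ^ ?f z * ((\<Prod>k\<in>UNIV - {i, z}. X k ^ ?f k) * (X i ^ ?f i :: ('n, 'k) mpoly))"
  proof -
    have "(UNIV :: 'n set) = insert z (insert i (UNIV - {i, z}))" by auto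
    then have "(\<Prod>k\<in>UNIV. X k ^ ?f k) =
        (\<Prod>k\<in>insert z (insert i (UNIV - {i, z})). (X k ^ ?f k :: ('n, 'k) mpoly))"
      by simp
    also have "\<dots> = X z ^ ?f z * (X i ^ ?f i * (\<Prod>k\<in>UNIV - {i, z}. X k ^ ?f k))"
      using assms by (subst prod.insert; simp)+
    finally show ?thesis by (simp add: mult.commute)
  qed
  ultimately show ?case
    by (simp add: single_eq_prod_X hams_Const)
next
  case zero
  show ?case
    using lie_subalgebraD(1)[OF L] by (simp add: hams_def hamiltonian_def pd_simps)
qed (rule hams_add)

text \<open>Hamiltonian fields in the planes of \<open>x_i\<close> and \<open>x_z\<close> match
  every coefficient except that of \<open>partial_deriv z\<close>; the divergence condition makes
  the remainder Hamiltonian too.\<close>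

lemma div0_subset:
  assumes "\<exists>k. k \<noteq> z"
  shows "div0 \<subseteq> L"
proof
  fix \<delta> :: "('n, 'k) mpoly_op"
  assume "\<delta> \<in> div0"
  then have \<delta>: "\<delta> \<in> derivations" "divergence \<delta> = 0" by (auto simp: div0_def)
  have split_z: "sum g UNIV = g z + sum g (UNIV - {z})" for g :: "'n \<Rightarrow> ('n, 'k) mpoly"
    by (simp add: sum.remove)
  have "\<exists>q. partial_deriv z q = \<delta> (X i)" for i
    by (rule antiderivative_exists[where i = z and p = "\<delta> (X i)"]) (rule exI)
  then obtain F where F: "partial_deriv z (F i) = \<delta> (X i)" for i by metis
  \<comment> \<open>The coefficient of \<open>partial_deriv z\<close> left after subtracting the
    fields of all \<open>F i\<close>.\<close>
  define b where "b = \<delta> (X z) + (\<Sum>i\<in>UNIV - {z}. partial_deriv i (F i))"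
  have "partial_deriv z b = divergence \<delta>"
    unfolding b_def divergence_def split_z
    by (simp add: pd_simps partial_deriv_sum partial_deriv_commute[of z] F)
  then have b: "partial_deriv z b = 0" using \<delta> by simp
  obtain k where k: "k \<noteq> z" using assms by blast
  \<comment> \<open>As \<open>G\<close> is free of \<open>x_z\<close>, its field has no component
    along \<open>partial_deriv k\<close> and equals
    \<open>- b \<odot> partial_deriv z\<close>.\<close>
  obtain G where G: "partial_deriv k G = b" "partial_deriv z G = 0"
    by (rule antiderivative_exists[of k b]) (use b k in simp)
  have ham: "hamiltonian i z f \<in> L" if "i \<noteq> z" for i f
    using hams_eq_UNIV[OF that] by (simp add: hams_def)
  have "(\<lambda>p. (\<Sum>i\<in>UNIV - {z}. hamiltonian i z (F i) p) + - hamiltonian k z G p) \<in> L"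
    by (rule lie_subalgebraD(2)[OF L lie_subalgebra_sum[OF L] lie_subalgebra_uminus[OF L]])
      (simp_all add: ham k)
  also have "(\<lambda>p. (\<Sum>i\<in>UNIV - {z}. hamiltonian i z (F i) p) + - hamiltonian k z G p) = \<delta>"
  proof
    fix p
    have "\<delta> p = (\<Sum>i\<in>UNIV. \<delta> (X i) * partial_deriv i p)"
      by (rule fun_cong[OF derivation_expand[OF \<delta>(1)]])
    then show "(\<Sum>i\<in>UNIV - {z}. hamiltonian i z (F i) p) + - hamiltonian k z G p = \<delta> p"
      unfolding split_z
      by (simp add: hamiltonian_def F G b_def sum_subtractf sum_distrib_right distrib_right)
  qed
  finally show "\<delta> \<in> L" .
qed

end


section \<open>Minimality\<close>

lemma field_derivation: "a \<odot> partial_deriv i \<in> derivations"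
  by (auto simp: derivations_def scale_def pd_simps algebra_simps)

lemma field_in_div0:
  assumes "partial_deriv i a = 0"
  shows "a \<odot> partial_deriv i \<in> div0"
  unfolding div0_def mem_Collect_eq
  using assms
  by (intro conjI field_derivation)
    (auto simp: divergence_def scale_def partial_deriv_X pd_simps intro!: sum.neutral)

lemma lie_subalgebra_stabiliser:
  assumes V: "0 \<in> V" "\<And>p q. p \<in> V \<Longrightarrow> q \<in> V \<Longrightarrow> p + q \<in> V" "\<And>c p. p \<in> V \<Longrightarrow> Const c * p \<in> V"
  shows "lie_subalgebra {\<delta> \<in> derivations. \<forall>p\<in>V. \<delta> p \<in> V}"
proof -
  have "p - q \<in> V" if "p \<in> V" "q \<in> V" for p q
    using V(2)[OF that(1) V(3)[OF that(2), of "-1"]] by (simp add: Const_uminus_1)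
  then show ?thesis
    using lie_subalgebra_derivations[where 'a = 'a and 'b = 'b] V
    unfolding lie_subalgebra_def by (auto simp: scale_def lie_bracket_def)
qed

text \<open>The stabiliser of \<open>V\<close> is a Lie subalgebra containing \<open>T\<close>,
  hence the hull of \<open>T\<close>, but it misses \<open>\<epsilon>\<close>.\<close>

lemma not_generates_stabiliser:
  assumes "0 \<in> V" "\<And>p q. p \<in> V \<Longrightarrow> q \<in> V \<Longrightarrow> p + q \<in> V" "\<And>c p. p \<in> V \<Longrightarrow> Const c * p \<in> V"
    and "T \<subseteq> derivations" "\<And>\<delta> p. \<delta> \<in> T \<Longrightarrow> p \<in> V \<Longrightarrow> \<delta> p \<in> V"
    and "\<epsilon> \<in> M" "q \<in> V" "\<epsilon> q \<notin> V"
  shows "\<not> lie_generates T M"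
proof
  assume "lie_generates T M"
  moreover have "lie_subalgebra hull T \<subseteq> {\<delta> \<in> derivations. \<forall>p\<in>V. \<delta> p \<in> V}"
    using assms(4,5) by (intro hull_minimal lie_subalgebra_stabiliser assms(1-3)) auto
  ultimately show False
    using assms(6-8) by (auto simp: lie_generates_def)
qed

lemma minimal_lie_generators_div0:
  fixes z :: "'n::finite"
  assumes "\<exists>k. k \<noteq> z"
  shows "minimal_lie_generators
    ({partial_deriv z} \<union> {X i ^ 2 \<odot> partial_deriv z | i. i \<noteq> z} \<union> {X z ^ 2 \<odot> partial_deriv i | i. i \<noteq> z})
    (div0 :: ('n, 'k::field_char_0) mpoly_op set)"
    (is "minimal_lie_generators ?S _")
  unfolding minimal_lie_generators_def
proof (intro conjI allI impI)
  have "1 \<odot> partial_deriv z \<in> (div0 :: ('n, 'k) mpoly_op set)"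
    by (intro field_in_div0 pd_simps)
  then have S: "?S \<subseteq> div0"
    by (auto intro!: field_in_div0 simp: partial_deriv_power partial_deriv_X)
      (simp add: scale_def)
  show "lie_generates ?S div0"
    unfolding lie_generates_def
  proof (intro equalityI)
    show "lie_subalgebra hull ?S \<subseteq> div0"
      by (intro hull_minimal S lie_subalgebra_div0)
    \<comment> \<open>Every Lie subalgebra in the intersection defining the hull satisfies the
      hypotheses of \<open>div0_subset\<close>.\<close>
    show "div0 \<subseteq> lie_subalgebra hull ?S"
      unfolding hull_def by (intro Inter_greatest div0_subset[where z = z] assms) auto
  qed
  fix T assume T: "T \<subset> ?S"
  then obtain g where g: "g \<in> ?S" "g \<notin> T" by blast
  have T': "T \<subseteq> derivations" and g': "g \<in> div0"
    using T S g(1) by (auto simp: div0_def)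
  from g(1) consider "g = partial_deriv z"
    | i where "i \<noteq> z" "g = X i ^ 2 \<odot> partial_deriv z"
    | i where "i \<noteq> z" "g = X z ^ 2 \<odot> partial_deriv i"
    by blast
  then show "\<not> lie_generates T (div0 :: ('n, 'k) mpoly_op set)"
  proof cases
    case 1
    \<comment> \<open>The coefficient at exponent 0 is the constant term. The other generators have
      a square as coefficient, so their values lie in the maximal ideal, while
      \<open>partial_deriv z\<close> sends \<open>X z\<close> to 1.\<close>
    have lookup0: "Poly_Mapping.lookup (X i ^ 2 * p) 0 = 0" for i :: 'n and p :: "('n, 'k) mpoly"
    proof (induction p rule: mpoly_induct)
      case (single m c)
      have "Poly_Mapping.single i 2 + m \<noteq> 0"
        by (metis add_is_0 lookup_add lookup_single_eq lookup_zero zero_neq_numeral)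
      then show ?case by (simp add: X_power mult_single lookup_single)
    qed (simp_all add: algebra_simps lookup_add)
    have Const0: "Poly_Mapping.lookup (Const c * p) 0 = c * Poly_Mapping.lookup p 0"
      for c and p :: "('n, 'k) mpoly"
      by (induction p rule: mpoly_induct)
        (simp_all add: Const_def mult_single lookup_single when_def lookup_add algebra_simps)
    have "\<delta> p \<in> {p. Poly_Mapping.lookup p 0 = 0}" if "\<delta> \<in> T" for \<delta> p
    proof -
      from that obtain i j where "\<delta> = X i ^ 2 \<odot> partial_deriv j" using T g(2) 1 by blast
      then show ?thesis by (simp add: scale_def lookup0)
    qed
    moreover have "Poly_Mapping.single z (Suc 0) \<noteq> 0"
      by (metis lookup_single_eq lookup_zero nat.distinct(1))
    ultimately show ?thesis
      by (intro not_generates_stabiliser[of "{p. Poly_Mapping.lookup p 0 = 0}" T g _ "X z"] T' g')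
        (auto simp: 1 partial_deriv_X lookup_add Const0 X_def[of z] lookup_single
            partial_deriv_single lookup_one)
  next
    case (2 i)
    \<comment> \<open>The other generators have coefficients free of \<open>x_i\<close>; the missing
      one sends \<open>X z\<close> to \<open>X i ^ 2\<close>, whose derivative
      \<open>2 * X i\<close> is nonzero in characteristic zero.\<close>
    let ?V = "{p :: ('n, 'k) mpoly. partial_deriv i p = 0}"
    have "\<delta> p \<in> ?V" if "\<delta> \<in> T" "p \<in> ?V" for \<delta> p
    proof -
      have comm: "partial_deriv i (partial_deriv j p) = 0" for j
        using that(2) by (simp add: partial_deriv_commute[of i j] pd_simps)
      from that(1) have "\<delta> \<in> ?S" "\<delta> \<noteq> g" using T g(2) by blast+
      consider "\<delta> = partial_deriv z"
        | k where "k \<noteq> i" "\<delta> = X k ^ 2 \<odot> partial_deriv z"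
        | k where "\<delta> = X z ^ 2 \<odot> partial_deriv k"
        using \<open>\<delta> \<in> ?S\<close> \<open>\<delta> \<noteq> g\<close> 2(2) by fastforce
      then show ?thesis
        using \<open>i \<noteq> z\<close>
        by cases (auto simp: comm scale_def partial_deriv_mult partial_deriv_power partial_deriv_X)
    qed
    moreover have "of_nat 2 * (X i :: ('n, 'k) mpoly) \<noteq> 0"
      unfolding Const_of_nat[symmetric] by (simp add: Const_mult_X_eq_0)
    ultimately show ?thesis
      using \<open>i \<noteq> z\<close>
      by (intro not_generates_stabiliser[of ?V T g _ "X z"] T' g')
        (auto simp: 2 pd_simps scale_def partial_deriv_power partial_deriv_X)
  next
    case (3 i)
    \<comment> \<open>The other generators differentiate along variables different from
      \<open>x_i\<close> and so annihilate \<open>?V\<close>; the missing one sends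
      \<open>X i\<close> to \<open>X z ^ 2\<close>.\<close>
    let ?V = "{p :: ('n, 'k) mpoly. \<forall>j. j \<noteq> i \<longrightarrow> partial_deriv j p = 0}"
    have "\<delta> p \<in> ?V" if "\<delta> \<in> T" "p \<in> ?V" for \<delta> p
    proof -
      from that(1) have "\<delta> \<in> ?S" "\<delta> \<noteq> g" using T g(2) by blast+
      consider "\<delta> = partial_deriv z"
        | k where "\<delta> = X k ^ 2 \<odot> partial_deriv z"
        | k where "k \<noteq> i" "\<delta> = X z ^ 2 \<odot> partial_deriv k"
        using \<open>\<delta> \<in> ?S\<close> \<open>\<delta> \<noteq> g\<close> 3(2) by fastforce
      then have "\<delta> p = 0"
        using \<open>i \<noteq> z\<close> that(2) by cases (auto simp: scale_def)
      then show ?thesis by (simp add: pd_simps)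
    qed
    moreover
    have "of_nat 2 * (X z :: ('n, 'k) mpoly) \<noteq> 0"
      unfolding Const_of_nat[symmetric] by (simp add: Const_mult_X_eq_0)
    then have "partial_deriv z (g (X i)) \<noteq> 0"
      by (simp add: 3 scale_def partial_deriv_mult partial_deriv_power partial_deriv_X)
    then have "g (X i) \<notin> ?V"
      using \<open>i \<noteq> z\<close> by auto
    ultimately show ?thesis
      by (intro not_generates_stabiliser[of ?V T g _ "X i"] T' g')
        (auto simp: pd_simps partial_deriv_X)
  qed
qed

theorem theorem1p3:
  fixes n :: nat and e :: "nat \<Rightarrow> 'n::finite"
  assumes "n \<ge> 2" and "bij_betw e {1..n} (UNIV :: 'n set)"
  shows "minimal_lie_generators
    ({partial_deriv (e 1)} \<union>
     {X (e i) ^ 2 \<odot> partial_deriv (e 1) | i. i \<in> {2..n}} \<union>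
     {X (e 1) ^ 2 \<odot> partial_deriv (e i) | i. i \<in> {2..n}})
    (div0 :: ('n, 'k::field_char_0) mpoly_op set)"
proof -
  have "{1..n} = insert 1 {2..n}" using assms(1) by auto
  then have cover: "insert (e 1) (e ` {2..n}) = UNIV"
    using bij_betw_imp_surj_on[OF assms(2)] by simp
  have neq: "e i \<noteq> e 1" if "i \<in> {2..n}" for i
    using that assms(1) inj_onD[OF bij_betw_imp_inj_on[OF assms(2)], of i 1] by auto
  have img: "{k. k \<noteq> e 1} = e ` {2..n}"
  proof (intro equalityI subsetI)
    fix k assume "k \<in> {k. k \<noteq> e 1}"
    moreover have "k \<in> insert (e 1) (e ` {2..n})"
      unfolding cover by (rule UNIV_I)
    ultimately show "k \<in> e ` {2..n}" by simp
  qed (use neq in auto)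
  have reindex: "{h (e i) | i. i \<in> {2..n}} = {h k | k. k \<noteq> e 1}"
    for h :: "'n \<Rightarrow> ('n, 'k) mpoly_op"
  proof -
    have "{h (e i) | i. i \<in> {2..n}} = h ` (e ` {2..n})"
      by (auto simp del: atLeastAtMost_iff)
    also have "\<dots> = {h k | k. k \<noteq> e 1}" unfolding img[symmetric] by auto
    finally show ?thesis .
  qed
  \<comment> \<open>A second variable exists because \<open>n \<ge> 2\<close>; \<open>e 2\<close> is
    one.\<close>
  have "\<exists>k. k \<noteq> e 1"
    using neq[of 2] assms(1) by auto
  then show ?thesis
    unfolding reindex[of "\<lambda>k. X k ^ 2 \<odot> partial_deriv (e 1)"]
      reindex[of "\<lambda>k. X (e 1) ^ 2 \<odot> partial_deriv k"]
    by (rule minimal_lie_generators_div0)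
qed

end
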